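(* Let $\tau$ be a positive integer such that $2^{2^\tau}-1$ has at least two distinct primitive prime divisors. For each $1\le j\le\tau$ let $p_j$ be a primitive prime divisor of $2^{2^j}-1$, and let $q$ be a primitive prime divisor of $2^{2^\tau}-1$ with $q\ne p_\tau$. Let $b>2$ be an integer with $b\not\equiv 0\pmod q$, and for each $1\le j\le\tau$ define $$\ell_j=\begin{cases}1 & \text{if } b\equiv 0\pmod{p_j},\\ p_j & \text{if } b\equiv 1\pmod{p_j},\\ \operatorname{ord}_{p_j}(b) & \text{otherwise},\end{cases}$$ and let $L=\operatorname{lcm}(2,\ell_1,\ldots,\ell_\tau)$. Suppose $b$ satisfies one of the following: (i) $b\equiv1\pmod q$ and $q\nmid L$; (ii) $b\not\equiv 1\pmod q$ and there exists an integer $t$ with $(b^t-1)/(b-1)\equiv -1\pmod q$ and $t\equiv 1\pmod L$. Then there exist infinitely many $b$-repunits that are Sierpiński numbers.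
   Context: For a positive integer $m$, a prime $p$ is a primitive prime divisor of $2^m-1$ if $p\mid 2^m-1$ and $p\nmid 2^\mu-1$ for every positive integer $\mu<m$. $\operatorname{ord}_p(b)$ is the multiplicative order of $b$ modulo $p$. For $b\ge2$ and $t\ge1$, the $b$-repunit $1_b^{(t)}$ is $(b^t-1)/(b-1)$. A Sierpiński number is an odd positive integer $k$ such that $k\cdot 2^n+1$ is composite for all positive integers $n$. *)

theory Defs
  imports Complex_Main "HOL-Number_Theory.Number_Theory"
begin

definition primitive_prime_divisor :: "nat \<Rightarrow> nat \<Rightarrow> bool" where
  "primitive_prime_divisor m p \<longleftrightarrow>
     m > 0 \<and> prime p \<and> p dvd 2 ^ m - 1 \<and> (\<forall>\<mu>. 0 < \<mu> \<and> \<mu> < m \<longrightarrow> \<not> p dvd 2 ^ \<mu> - 1)"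

text \<open>The division is exact, since \<open>b - 1\<close> divides \<open>b ^ t - 1\<close>.\<close>

definition repunit :: "nat \<Rightarrow> nat \<Rightarrow> nat" where
  "repunit b t = (b ^ t - 1) div (b - 1)"

definition composite :: "nat \<Rightarrow> bool" where
  "composite n \<longleftrightarrow> n > 1 \<and> \<not> prime n"

definition sierpinski_number :: "nat \<Rightarrow> bool" where
  "sierpinski_number k \<longleftrightarrow> k > 0 \<and> odd k \<and> (\<forall>n>0. composite (k * 2 ^ n + 1))"

text \<open>
  Congruence of rational numbers modulo \<open>q\<close>: the difference is \<open>q\<close> times a fraction whose
  denominator is coprime to \<open>q\<close>. It is needed because \<open>(b\<^sup>t - 1) / (b - 1)\<close> is not an integer
  in general when the integer \<open>t\<close> is negative; between integers it is the usual congruence.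
  (The library's \<open>cong\<close> is of no use at type \<open>rat\<close>, where every nonzero element is a unit.)
\<close>

definition rat_cong :: "rat \<Rightarrow> rat \<Rightarrow> nat \<Rightarrow> bool" where
  "rat_cong x y q \<longleftrightarrow>
     (\<exists>u v :: int. v \<noteq> 0 \<and> coprime v (int q) \<and> x - y = of_nat q * (of_int u / of_int v))"

lemma rat_cong_of_int:
  "rat_cong (of_int x) (of_int y) q \<longleftrightarrow> [x = y] (mod int q)"
proof
  assume "rat_cong (of_int x) (of_int y) q"
  then obtain u v :: int where v: "v \<noteq> 0" "coprime v (int q)"
    and eq: "of_int x - of_int y = (of_nat q * (of_int u / of_int v) :: rat)"
    unfolding rat_cong_def by blast
  have "(of_int ((x - y) * v) :: rat) = of_int (int q * u)"
    using eq v(1) by (simp add: field_simps)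
  hence "(x - y) * v = int q * u"
    by (simp only: of_int_eq_iff)
  hence "int q dvd (x - y) * v"
    by simp
  with v(2) have "int q dvd x - y"
    by (simp add: coprime_dvd_mult_left_iff coprime_commute)
  thus "[x = y] (mod int q)"
    by (simp add: cong_iff_dvd_diff)
next
  assume "[x = y] (mod int q)"
  then obtain u where "x - y = int q * u"
    by (auto simp: cong_iff_dvd_diff dvd_def)
  hence "(of_int (x - y) :: rat) = of_int (int q * u)"
    by (simp only:)
  thus "rat_cong (of_int x) (of_int y) q"
    unfolding rat_cong_def by (intro exI[of _ u] exI[of _ 1]) simp
qed

end

(*
  Since p_j divides 2^(2^j) - 1 but not 2^(2^(j-1)) - 1, it divides 2^(2^(j-1)) + 1. Hence if
  k = 1 (mod p_j) for all j and k = -1 (mod q), then k * 2^n + 1 is divisible by p_j for n an odd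
  multiple of 2^(j-1), and by q for n a multiple of 2^tau; these classes cover all n. The choice of
  L gives repunit b t = 1 (mod p_j) as soon as t = 1 (mod L). The remaining congruence modulo q
  restricts t modulo q when b = 1 (mod q), which is compatible with t = 1 (mod L) by the Chinese
  remainder theorem, and modulo q - 1 otherwise, where the given exponent may be shifted by
  multiples of L * (q - 1). Either way there are arbitrarily large admissible t.
*)
theory Submission
  imports Defs
begin

section \<open>Repunits as geometric sums and their residues\<close>

lemma repunit_mult:
  assumes "b \<ge> 2"
  shows "repunit b t * (b - 1) = b ^ t - 1"
proof -
  have "[b ^ t = 1 ^ t] (mod (b - 1))"
    using assms by (intro cong_pow) (simp add: cong_altdef_nat)
  hence "(b - 1) dvd b ^ t - 1"
    using assms by (simp add: cong_altdef_nat)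
  thus ?thesis
    by (simp add: repunit_def)
qed

lemma repunit_conv_sum:
  assumes "b \<ge> 2"
  shows "repunit b t = (\<Sum>i<t. b ^ i)"
proof -
  have "int (repunit b t * (b - 1)) = int ((\<Sum>i<t. b ^ i) * (b - 1))"
    unfolding repunit_mult[OF assms]
    using assms power_diff_1_eq[of "int b" t] by (simp add: of_nat_diff mult.commute)
  thus ?thesis
    using assms by (simp only: of_nat_eq_iff) simp
qed

lemma int_repunit_mult:
  assumes "b \<ge> 2"
  shows "int (repunit b t) * (int b - 1) = int b ^ t - 1"
proof -
  have "int (repunit b t * (b - 1)) = int (b ^ t - 1)"
    using repunit_mult[OF assms] by simp
  thus ?thesis
    using assms by (simp add: of_nat_diff)
qed

text \<open>Each of the \<open>t\<close> terms of the geometric sum is at least 1. Large exponents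
  thus give large repunits, which is used both for infinitude and for exceeding the covering
  primes.\<close>

lemma repunit_ge:
  assumes "b \<ge> 2"
  shows "t \<le> repunit b t"
proof -
  have "(\<Sum>i<t. 1) \<le> (\<Sum>i<t. b ^ i)"
    using assms by (intro sum_mono) simp
  thus ?thesis
    by (simp add: repunit_conv_sum[OF assms])
qed

text \<open>Every term of the geometric sum except \<open>b ^ 0\<close> is a multiple of
  \<open>m\<close>.\<close>

lemma repunit_cong_1_of_dvd:
  assumes "b \<ge> 2" "t \<ge> 1" "m dvd b"
  shows "[repunit b t = 1] (mod m)"
proof -
  obtain s where t: "t = Suc s"
    using assms(2) by (cases t) auto
  have "m dvd (\<Sum>i<s. b ^ Suc i)"
    using assms(3) by (intro dvd_sum) simp
  moreover have "repunit b t = 1 + (\<Sum>i<s. b ^ Suc i)"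
    unfolding repunit_conv_sum[OF assms(1)] t by (subst sum.lessThan_Suc_shift) simp
  ultimately show ?thesis
    by (metis cong_0_iff cong_add_lcancel_0_nat)
qed

text \<open>Every term of the geometric sum is 1 modulo \<open>m\<close>, and there are
  \<open>t\<close> of them.\<close>

lemma repunit_cong_of_cong_1:
  assumes "b \<ge> 2" "[b = 1] (mod m)"
  shows "[repunit b t = t] (mod m)"
proof -
  have "[(\<Sum>i<t. b ^ i) = (\<Sum>i<t. 1)] (mod m)"
    using cong_pow[OF assms(2)] by (intro cong_sum) simp
  thus ?thesis
    by (simp add: repunit_conv_sum[OF assms(1)])
qed

text \<open>The condition on \<open>t\<close> gives \<open>b ^ t = b\<close> modulo
  \<open>m\<close>, so the repunit times \<open>b - 1\<close> is congruent to \<open>b - 1\<close>,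
  and this factor is invertible because \<open>b\<close> is not 1 modulo the prime
  \<open>m\<close>.\<close>

lemma repunit_cong_1_of_ord:
  assumes "b \<ge> 2" "prime m" "\<not> [b = 0] (mod m)" "\<not> [b = 1] (mod m)" "[t = 1] (mod ord m b)"
  shows "[repunit b t = 1] (mod m)"
proof -
  have "\<not> m dvd b"
    using assms(3) by (simp add: cong_0_iff)
  hence "coprime m b"
    using assms(2) prime_imp_coprime by blast
  hence "[b ^ t = b ^ 1] (mod m)"
    using assms(5) order_divides_expdiff by blast
  hence "[int b ^ t - 1 = int b - 1] (mod int m)"
    by (intro cong_diff) (simp_all flip: of_nat_power add: cong_int_iff)
  hence "[int (repunit b t) * (int b - 1) = 1 * (int b - 1)] (mod int m)"
    by (simp add: int_repunit_mult[OF assms(1)])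
  moreover have "\<not> int m dvd int b - 1"
    using assms(4) by (metis cong_iff_dvd_diff cong_int_iff of_nat_1)
  hence "coprime (int b - 1) (int m)"
    using assms(2) by (metis coprime_commute prime_imp_coprime prime_nat_int_transfer)
  ultimately have "[int (repunit b t) = int 1] (mod int m)"
    by (metis cong_mult_rcancel of_nat_1)
  thus ?thesis
    by (simp only: cong_int_iff)
qed

lemma odd_repunit:
  assumes "b \<ge> 2" "odd t"
  shows "odd (repunit b t)"
proof (cases "even b")
  case True
  have "t \<ge> 1"
    using assms(2) by (cases t) auto
  hence "[repunit b t = 1] (mod 2)"
    using repunit_cong_1_of_dvd[OF assms(1)] True by blast
  thus ?thesis
    by (simp add: cong_def odd_iff_mod_2_eq_one)
next
  case False
  hence "[b = 1] (mod 2)"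
    by (simp add: cong_def odd_iff_mod_2_eq_one)
  hence "[repunit b t = t] (mod 2)"
    by (rule repunit_cong_of_cong_1[OF assms(1)])
  thus ?thesis
    using assms(2) by (simp add: cong_def odd_iff_mod_2_eq_one)
qed

section \<open>The covering of the exponents\<close>

lemma primitive_prime_divisor_cong_minus_1:
  assumes "primitive_prime_divisor (2 ^ Suc a) r"
  shows "[2 ^ 2 ^ a = -1] (mod int r)"
proof -
  have r: "prime r" "r dvd 2 ^ 2 ^ Suc a - 1" "\<not> r dvd 2 ^ 2 ^ a - 1"
    using assms unfolding primitive_prime_divisor_def by auto
  have eq: "(2 ^ 2 ^ Suc a - 1 :: nat) = (2 ^ 2 ^ a - 1) * (2 ^ 2 ^ a + 1)"
    by (simp add: algebra_simps mult_2 power_add)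
  have "r dvd 2 ^ 2 ^ a + 1"
    using r unfolding eq by (simp only: prime_dvd_mult_iff) simp
  hence "int r dvd int (2 ^ 2 ^ a + 1)"
    by (simp only: int_dvd_int_iff)
  thus ?thesis
    by (simp add: cong_iff_dvd_diff add.commute)
qed

lemma composite_of_prime_dvd:
  assumes "prime r" "r dvd n" "r < n"
  shows "composite n"
  using assms prime_nat_iff[of n] prime_gt_1_nat[of r] unfolding composite_def by auto

text \<open>The lower bounds on \<open>k\<close> ensure that the covering primes are proper divisors
  of \<open>k * 2 ^ n + 1\<close>, so that divisibility yields compositeness.\<close>

lemma sierpinski_of_covering:
  assumes "\<And>j. j \<in> {1..\<tau>} \<Longrightarrow> primitive_prime_divisor (2 ^ j) (p j)"
    and "primitive_prime_divisor (2 ^ \<tau>) q"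
    and p1: "\<And>j. j \<in> {1..\<tau>} \<Longrightarrow> [k = 1] (mod p j)"
    and q1: "q dvd k + 1"
    and p_le: "\<And>j. j \<in> {1..\<tau>} \<Longrightarrow> p j \<le> k"
    and q_le: "q \<le> k"
    and "odd k"
  shows "sierpinski_number k"
proof -
  have "k > 0"
    using \<open>odd k\<close> by (cases k) auto
  have less: "k < k * 2 ^ n + 1" for n :: nat
    by (simp add: less_Suc_eq_le)
  have "composite (k * 2 ^ n + 1)" if "n > 0" for n
  proof -
    \<comment> \<open>The 2-adic valuation \<open>a\<close> of \<open>n\<close> selects the prime:
      \<open>p (Suc a)\<close> if \<open>a < \<tau>\<close>, and \<open>q\<close> otherwise.\<close>
    have "\<exists>a c. n = 2 ^ a * c \<and> odd c"
      using that multiplicity_decompose'[of n 2] by (metis neq0_conv odd_one)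
    then obtain a c where n: "n = 2 ^ a * c" and "odd c"
      by blast
    show ?thesis
    proof (cases "a < \<tau>")
      case True
      let ?r = "p (Suc a)"
      have j: "Suc a \<in> {1..\<tau>}"
        using True by simp
      have "[(2 ^ 2 ^ a) ^ c = (-1) ^ c] (mod int ?r)"
        using primitive_prime_divisor_cong_minus_1 assms(1)[OF j] cong_pow by blast
      hence "[2 ^ n = -1] (mod int ?r)"
        using \<open>odd c\<close> by (simp add: n power_mult)
      moreover have "[int k = 1] (mod int ?r)"
        using p1[OF j] by (simp flip: cong_int_iff)
      ultimately have "[int k * 2 ^ n + 1 = 1 * (-1) + 1] (mod int ?r)"
        by (intro cong_add cong_mult) auto
      hence "int ?r dvd int (k * 2 ^ n + 1)"
        by (simp add: cong_0_iff add.commute)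
      hence "?r dvd k * 2 ^ n + 1"
        by (simp only: int_dvd_int_iff)
      moreover have "prime ?r"
        using assms(1)[OF j] by (simp add: primitive_prime_divisor_def)
      ultimately show ?thesis
        using composite_of_prime_dvd p_le[OF j] less[of n] order.strict_trans1 by blast
    next
      case False
      hence "2 ^ \<tau> dvd n"
        by (simp add: n le_imp_power_dvd)
      then obtain d where d: "n = 2 ^ \<tau> * d"
        by blast
      have q: "prime q" "q dvd 2 ^ 2 ^ \<tau> - 1"
        using assms(2) by (auto simp: primitive_prime_divisor_def)
      hence "[2 ^ 2 ^ \<tau> = 1] (mod q)"
        by (simp add: cong_altdef_nat)
      hence "[(2 ^ 2 ^ \<tau>) ^ d = 1 ^ d] (mod q)"
        by (rule cong_pow)
      hence "[k * 2 ^ n + 1 = k * 1 + 1] (mod q)"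
        by (intro cong_add cong_mult) (auto simp: d power_mult)
      hence "q dvd k * 2 ^ n + 1"
        using q1 cong_dvd_iff by fastforce
      thus ?thesis
        using composite_of_prime_dvd q(1) q_le less[of n] order.strict_trans1 by blast
    qed
  qed
  thus ?thesis
    using \<open>k > 0\<close> \<open>odd k\<close> by (simp add: sierpinski_number_def)
qed

section \<open>Arbitrarily large admissible exponents\<close>

text \<open>Modulo \<open>q\<close> the repunit is just \<open>t\<close>, so the task is to solve
  \<open>t = 1\<close> modulo \<open>L\<close> and \<open>t = -1\<close> modulo \<open>q\<close>,
  the latter written as \<open>q - 1\<close> in the naturals.\<close>

lemma exists_large_exponent_cong_1:
  assumes "b \<ge> 2" "prime q" "[b = 1] (mod q)" "\<not> q dvd L" "L > 0"
  shows "\<exists>t\<ge>N. [t = 1] (mod L) \<and> q dvd repunit b t + 1"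
proof -
  have "coprime L q"
    using prime_imp_coprime[OF assms(2,4)] by (simp add: coprime_commute)
  then obtain x where x: "[x = 1] (mod L)" "[x = q - 1] (mod q)"
    using binary_chinese_remainder_nat by blast
  \<comment> \<open>Adding \<open>N\<close> copies of \<open>L * q\<close>, which is positive, keeps
    both residues and pushes the exponent beyond \<open>N\<close>.\<close>
  let ?t = "x + N * (L * q)"
  have "[?t = 1 + 0] (mod L)" "[?t = q - 1 + 0] (mod q)"
    by (intro cong_add x; simp add: cong_0_iff)+
  hence tL: "[?t = 1] (mod L)" and tq: "[?t = q - 1] (mod q)"
    by simp_all
  have "[repunit b ?t + 1 = (q - 1) + 1] (mod q)"
    using repunit_cong_of_cong_1[OF assms(1,3)] tq cong_trans cong_add cong_refl by blast
  moreover have "(q - 1) + 1 = q"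
    using prime_gt_0_nat[OF assms(2)] by simp
  ultimately have "q dvd repunit b ?t + 1"
    by (simp add: cong_dvd_iff)
  moreover have "N * 1 \<le> N * (L * q)"
    using assms(5) prime_gt_0_nat[OF assms(2)] by (intro mult_le_mono) auto
  hence "?t \<ge> N"
    by linarith
  ultimately show ?thesis
    using tL by blast
qed

text \<open>The given \<open>t\<close> may be negative. Adding a multiple of
  \<open>L * (q - 1)\<close> preserves its residue modulo \<open>L\<close> and, by Fermat, the power
  of \<open>b\<close> modulo \<open>q\<close>.\<close>

lemma exists_large_exponent_of_rat_cong:
  fixes t :: int
  assumes "b \<ge> 2" "prime q" "\<not> [b = 0] (mod q)" "\<not> [b = 1] (mod q)" "L > 0"
    and rc: "rat_cong ((of_nat b powi t - 1) / (of_nat b - 1)) (-1) q"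
    and tL: "[t = 1] (mod int L)"
  shows "\<exists>t\<ge>N. [t = 1] (mod L) \<and> q dvd repunit b t + 1"
proof -
  \<comment> \<open>Since \<open>e\<close> is at least \<open>s\<close>, the shifted exponent
    \<open>t + e\<close> is at least \<open>N\<close> even for negative \<open>t\<close>.\<close>
  define s where "s = N + nat \<bar>t\<bar>"
  define e where "e = L * (q - 1) * s"
  define T where "T = nat (t + int e)"
  have "s * 1 \<le> s * (L * (q - 1))"
    using assms(5) prime_gt_1_nat[OF assms(2)] by (intro mult_le_mono) auto
  hence "s \<le> e"
    by (simp add: e_def mult.commute)
  hence T: "int T = t + int e" and "T \<ge> N"
    unfolding T_def s_def by linarith+
  have "[int T = 1 + 0] (mod int L)"
    unfolding T by (intro cong_add tL) (simp add: e_def cong_0_iff)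
  hence TL: "[T = 1] (mod L)"
    by (simp flip: cong_int_iff)
  obtain u v :: int where v: "v \<noteq> 0" "coprime v (int q)"
    and "(of_nat b powi t - 1) / (of_nat b - 1) - (-1) = (of_nat q * (of_int u / of_int v) :: rat)"
    using rc unfolding rat_cong_def by blast
  moreover have "of_nat b - 1 \<noteq> (0 :: rat)"
    using assms(1) by simp
  \<comment> \<open>The denominators \<open>b - 1\<close> and \<open>v\<close> are cleared.
    Multiplying by \<open>b ^ e\<close> then turns the integer power into \<open>b ^ T\<close>,
    which makes the equation one between integers.\<close>
  ultimately have "of_int v * (of_nat b powi t + of_nat b - 2)
      = (of_nat q * of_int u * (of_nat b - 1) :: rat)"
    by (simp add: field_simps)
  hence "of_int v * (of_nat b powi t + of_nat b - 2) * of_nat b ^ e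
      = (of_nat q * of_int u * (of_nat b - 1) * of_nat b ^ e :: rat)"
    by simp
  moreover have "of_nat b powi t * of_nat b ^ e = (of_nat b ^ T :: rat)"
    using assms(1) T
    by (metis bot_nat_0.extremum_uniqueI not_numeral_le_zero of_nat_eq_0_iff power_int_add power_int_of_nat)
  ultimately have "(of_int (v * (int b ^ T + (int b - 2) * int b ^ e)) :: rat)
      = of_int (int q * (u * (int b - 1) * int b ^ e))"
    by (simp add: algebra_simps)
  hence "v * (int b ^ T + (int b - 2) * int b ^ e) = int q * (u * (int b - 1) * int b ^ e)"
    by (simp only: of_int_eq_iff)
  hence "int q dvd v * (int b ^ T + (int b - 2) * int b ^ e)"
    by simp
  hence dvd: "int q dvd int b ^ T + (int b - 2) * int b ^ e"
    using v(2) by (simp add: coprime_dvd_mult_right_iff coprime_commute)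
  have "\<not> q dvd b"
    using assms(3) by (simp add: cong_0_iff)
  hence "[b ^ (q - 1) = 1] (mod q)"
    using assms(2) by (intro fermat_theorem)
  hence "[(b ^ (q - 1)) ^ (L * s) = 1 ^ (L * s)] (mod q)"
    by (rule cong_pow)
  moreover have "(b ^ (q - 1)) ^ (L * s) = b ^ e"
    unfolding e_def by (simp add: mult_ac flip: power_mult)
  ultimately have "[b ^ e = 1] (mod q)"
    by simp
  hence "[int b ^ e = 1] (mod int q)"
    by (simp flip: cong_int_iff)
  hence "[int b ^ T + (int b - 2) * int b ^ e = int b ^ T + (int b - 2) * 1] (mod int q)"
    by (intro cong_add cong_mult) auto
  \<comment> \<open>Here \<open>b ^ T + b - 2\<close> is \<open>(b ^ T - 1) + (b - 1)\<close>. The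
    prime \<open>q\<close> does not divide \<open>b - 1\<close>, so it must divide the other
    factor.\<close>
  moreover have "int b ^ T + (int b - 2) * 1 = int (repunit b T + 1) * (int b - 1)"
    using int_repunit_mult[OF assms(1), of T] by (simp add: algebra_simps)
  ultimately have "int q dvd int (repunit b T + 1) * (int b - 1)"
    using dvd by (metis cong_dvd_iff)
  moreover have "\<not> int q dvd int b - 1"
    using assms(4) by (metis cong_iff_dvd_diff cong_int_iff of_nat_1)
  moreover have "prime (int q)"
    using assms(2) by simp
  ultimately have "int q dvd int (repunit b T + 1)"
    using prime_dvd_mult_iff by blast
  hence "q dvd repunit b T + 1"
    by (simp only: int_dvd_int_iff)
  thus ?thesis
    using \<open>T \<ge> N\<close> TL by blast
qed

theorem theorem3p11:
  fixes \<tau> q b L :: nat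
    and p l :: "nat \<Rightarrow> nat"
  assumes "\<tau> > 0"
    and "\<exists>r s. r \<noteq> s \<and> primitive_prime_divisor (2 ^ \<tau>) r \<and> primitive_prime_divisor (2 ^ \<tau>) s"
    and "\<forall>j\<in>{1..\<tau>}. primitive_prime_divisor (2 ^ j) (p j)"
    and "primitive_prime_divisor (2 ^ \<tau>) q"
    and "q \<noteq> p \<tau>"
    and "b > 2"
    and "\<not> [b = 0] (mod q)"
    and "\<forall>j\<in>{1..\<tau>}. l j =
           (if [b = 0] (mod p j) then 1
            else if [b = 1] (mod p j) then p j
            else ord (p j) b)"
    and "L = Lcm (insert 2 (l ` {1..\<tau>}))"
    and "([b = 1] (mod q) \<and> \<not> q dvd L) \<or>
         (\<not> [b = 1] (mod q) \<and>
          (\<exists>t::int. rat_cong ((of_nat b powi t - 1) / (of_nat b - 1)) (-1) q \<and>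
                    [t = 1] (mod int L)))"
  shows "infinite {k. (\<exists>t\<ge>1. k = repunit b t) \<and> sierpinski_number k}"
proof -
  have b: "b \<ge> 2"
    using assms(6) by simp
  have primes: "prime (p j)" if "j \<in> {1..\<tau>}" for j
    using assms(3) that by (auto simp: primitive_prime_divisor_def)
  have "prime q"
    using assms(4) by (simp add: primitive_prime_divisor_def)
  have l_dvd: "l j dvd L" if "j \<in> {1..\<tau>}" for j
    using that by (auto simp: assms(9) intro!: dvd_Lcm)
  have "2 dvd L"
    by (simp add: assms(9) dvd_Lcm)
  \<comment> \<open>The value \<open>ord (p j) b\<close> would be 0 if \<open>b\<close> were not
    coprime to \<open>p j\<close>. Nonzero \<open>l j\<close> give \<open>L > 0\<close>; for
    \<open>L = 0\<close> the congruence \<open>[t = 1] (mod L)\<close> would force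
    \<open>t = 1\<close>.\<close>
  have l_nz: "l j \<noteq> 0" if "j \<in> {1..\<tau>}" for j
  proof -
    have "coprime (p j) b" if "\<not> [b = 0] (mod p j)"
      using that primes[OF \<open>j \<in> {1..\<tau>}\<close>] by (simp add: cong_0_iff prime_imp_coprime)
    thus ?thesis
      using assms(8) that prime_gt_0_nat[OF primes[OF that]] by (auto simp: ord_eq_0)
  qed
  have "0 \<notin> insert 2 (l ` {1..\<tau>})"
    using l_nz by force
  hence "L > 0"
    unfolding assms(9) by (intro Nat.gr0I) (simp add: Lcm_0_iff)
  have large: "\<exists>t\<ge>N. [t = 1] (mod L) \<and> q dvd repunit b t + 1" for N
    using assms(10)
  proof (elim disjE conjE exE)
    assume "[b = 1] (mod q)" "\<not> q dvd L"
    thus ?thesis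
      using exists_large_exponent_cong_1 b \<open>prime q\<close> \<open>L > 0\<close> by blast
  next
    fix t :: int
    assume "\<not> [b = 1] (mod q)" "[t = 1] (mod int L)"
      "rat_cong ((of_nat b powi t - 1) / (of_nat b - 1)) (-1) q"
    thus ?thesis
      using exists_large_exponent_of_rat_cong[OF b \<open>prime q\<close> assms(7)] \<open>L > 0\<close> by blast
  qed
  have "\<exists>k\<ge>N. (\<exists>t\<ge>1. k = repunit b t) \<and> sierpinski_number k" for N
  proof -
    \<comment> \<open>Through \<open>repunit_ge\<close>, this single bound makes the repunit at
      least \<open>N\<close>, \<open>q\<close> and every \<open>p j\<close>; the summand 1 gives
      \<open>t \<ge> 1\<close>.\<close>
    obtain t where t: "t \<ge> N + q + 1 + (\<Sum>j\<in>{1..\<tau>}. p j)" "[t = 1] (mod L)" "q dvd repunit b t + 1"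
      using large by blast
    have t_le: "t \<le> repunit b t"
      by (rule repunit_ge[OF b])
    \<comment> \<open>This is why 2 enters the \<open>Lcm\<close>: an odd exponent makes the repunit
      odd for either parity of \<open>b\<close>.\<close>
    have "[t = 1] (mod 2)"
      using t(2) \<open>2 dvd L\<close> cong_dvd_modulus_nat by blast
    hence "odd t"
      by (simp add: cong_def odd_iff_mod_2_eq_one)
    have "[repunit b t = 1] (mod p j)" if j: "j \<in> {1..\<tau>}" for j
    proof -
      have tl: "[t = 1] (mod l j)"
        using t(2) l_dvd[OF j] cong_dvd_modulus_nat by blast
      consider "[b = 0] (mod p j)" | "[b = 1] (mod p j)" "l j = p j"
        | "\<not> [b = 0] (mod p j)" "\<not> [b = 1] (mod p j)" "l j = ord (p j) b"
        using assms(8) j by (cases "[b = 0] (mod p j)"; cases "[b = 1] (mod p j)") auto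
      thus ?thesis
      proof cases
        case 1
        thus ?thesis
          using repunit_cong_1_of_dvd[OF b] t(1) by (simp add: cong_0_iff)
      next
        case 2
        thus ?thesis
          using repunit_cong_of_cong_1[OF b] tl by (metis cong_trans)
      next
        case 3
        thus ?thesis
          using repunit_cong_1_of_ord[OF b primes[OF j]] tl by simp
      qed
    qed
    moreover have "p j \<le> repunit b t" if "j \<in> {1..\<tau>}" for j
      using member_le_sum[of j "{1..\<tau>}" p] that t(1) t_le by simp
    ultimately have "sierpinski_number (repunit b t)"
      using assms(3,4) t(1,3) t_le odd_repunit[OF b \<open>odd t\<close>]
      by (intro sierpinski_of_covering[of \<tau> p q]) auto
    moreover have "t \<ge> 1" "repunit b t \<ge> N"
      using t(1) t_le by simp_all
    ultimately show ?thesis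
      by blast
  qed
  thus ?thesis
    by (simp add: infinite_nat_iff_unbounded_le)
qed

end
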